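(* Let $\lambda$ be a nonzero real number. The generating function of the heterogeneous Bell polynomials is given by the identity of formal power series in $t$ (with $x$ a variable) $$e^{x(e_{\lambda}^{-1}(-t)-1)}=\sum_{n=0}^{\infty}H_{n,\lambda}(x)\frac{t^{n}}{n!}.$$
   Context: For $\lambda\in\mathbb{R}$, $\lambda\neq 0$: $(x)_{0,\lambda}=1$, $(x)_{n,\lambda}=x(x-\lambda)\cdots(x-(n-1)\lambda)$ for $n\ge 1$; $\langle x\rangle_{0,\lambda}=1$, $\langle x\rangle_{n,\lambda}=x(x+\lambda)\cdots(x+(n-1)\lambda)$ for $n\ge 1$. The falling factorial is $(x)_0=1$, $(x)_n=x(x-1)\cdots(x-n+1)$ for $n\ge 1$. The degenerate exponential is the series $e_{\lambda}^{x}(t)=\sum_{n=0}^{\infty}(x)_{n,\lambda}\frac{t^n}{n!}$ (that is, $(1+\lambda t)^{x/\lambda}$); $e_\lambda^{-1}(-t)$ denotes $e_\lambda^{x}(s)$ at $x=-1$, $s=-t$ (that is, $(1-\lambda t)^{-1/\lambda}$). The heterogeneous Stirling numbers of the second kind $H_\lambda(n,k)$ are defined by the polynomial identity $\langle x\rangle_{n,\lambda}=\sum_{k=0}^{n}H_{\lambda}(n,k)(x)_{k}$ for $n\ge 0$, with $H_\lambda(n,k)=0$ for $k<0$ or $n<k$. The heterogeneous Bell polynomials are $H_{n,\lambda}(x)=\sum_{k=0}^{n}H_{\lambda}(n,k)x^{k}$, $n\ge 0$. *)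

theory Defs
  imports
    "HOL-Computational_Algebra.Polynomial"
    "HOL-Computational_Algebra.Formal_Power_Series"
begin

definition deg_falling :: "'a::comm_ring_1 \<Rightarrow> 'a \<Rightarrow> nat \<Rightarrow> 'a" where
  "deg_falling l x n = (\<Prod>i<n. x - of_nat i * l)"

definition deg_rising :: "'a::comm_ring_1 \<Rightarrow> 'a \<Rightarrow> nat \<Rightarrow> 'a" where
  "deg_rising l x n = (\<Prod>i<n. x + of_nat i * l)"

definition falling_fact :: "'a::comm_ring_1 \<Rightarrow> nat \<Rightarrow> 'a" where
  "falling_fact x n = (\<Prod>i<n. x - of_nat i)"

definition deg_exp :: "real \<Rightarrow> real \<Rightarrow> real fps" where
  "deg_exp l x = Abs_fps (\<lambda>n. deg_falling l x n / fact n)"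

text \<open>The polynomial variable $x$ is the element \<open>[:0, 1:]\<close> of \<^typ>\<open>real poly\<close>,
  and the scalar $\lambda$ is embedded as the constant polynomial \<open>[:l:]\<close>.\<close>

definition is_het_stirling_row :: "real \<Rightarrow> nat \<Rightarrow> (nat \<Rightarrow> real) \<Rightarrow> bool" where
  "is_het_stirling_row l n h \<longleftrightarrow>
     (\<forall>k>n. h k = 0) \<and>
     deg_rising [:l:] [:0, 1:] n = (\<Sum>k\<le>n. smult (h k) (falling_fact [:0, 1:] k))"

definition het_stirling :: "real \<Rightarrow> nat \<Rightarrow> nat \<Rightarrow> real" where
  "het_stirling l n = (THE h. is_het_stirling_row l n h)"

definition het_bell :: "real \<Rightarrow> nat \<Rightarrow> real poly" where
  "het_bell l n = (\<Sum>k\<le>n. smult (het_stirling l n k) ([:0, 1:] ^ k))"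

text \<open>Identities in $t$ with a polynomial variable $x$ live in \<^typ>\<open>real poly fps\<close>. A real series
  is embedded there coefficientwise. The library exponential series requires a field of
  coefficients, so it is taken over the reals and embedded.\<close>

definition fps_lift :: "real fps \<Rightarrow> real poly fps" where
  "fps_lift f = Abs_fps (\<lambda>n. [:fps_nth f n:])"

text \<open>Meaningful only for series with vanishing constant term, like any composition of formal
  power series.\<close>

definition exp_series :: "real poly fps \<Rightarrow> real poly fps" where
  "exp_series f = fps_compose (fps_lift (fps_exp 1)) f"

lemma deg_exp_arg_nth_0:
  "fps_nth (fps_const [:0, 1:] * (fps_lift (fps_compose (deg_exp l (-1)) (- fps_X)) - 1)) 0 = 0"
  by (simp add: fps_lift_def deg_exp_def deg_falling_def flip: one_pCons)

text \<open>The description defining \<^const>\<open>het_stirling\<close> denotes: the falling factorials form a basis.\<close>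

lemma falling_fact_degree_coeff:
  "degree (falling_fact [:0, 1:: real:] k) = k \<and> coeff (falling_fact [:0, 1:: real:] k) k = 1"
proof -
  have *: "falling_fact [:0, 1:: real:] k = (\<Prod>i<k. [:- real i, 1:])"
    unfolding falling_fact_def by (intro prod.cong) (auto simp: of_nat_poly)
  have d: "degree (falling_fact [:0, 1:: real:] k) = k"
    unfolding * by (subst degree_prod_sum_eq) auto
  moreover have "lead_coeff (falling_fact [:0, 1:: real:] k) = 1"
    unfolding * by (subst lead_coeff_prod) auto
  ultimately show ?thesis by simp
qed

lemma falling_fact_expansion:
  fixes p :: "real poly"
  assumes "degree p \<le> n"
  shows "\<exists>!h. (\<forall>k>n. h k = 0) \<and> p = (\<Sum>k\<le>n. smult (h k) (falling_fact [:0, 1:] k))"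
  using assms
proof (induction n arbitrary: p)
  case 0
  then obtain c where c: "p = [:c:]" by (auto elim: degree_eq_zeroE)
  show ?case
    by (rule ex1I[of _ "\<lambda>k. if k = 0 then c else 0"])
       (auto simp: c falling_fact_def fun_eq_iff)
next
  case (Suc n)
  let ?f = "falling_fact [:0, 1:: real:]"
  have fd: "degree (?f k) = k" "coeff (?f k) k = 1" for k
    using falling_fact_degree_coeff by auto
  define q where "q = p - smult (coeff p (Suc n)) (?f (Suc n))"
  have "degree q \<le> n"
  proof (rule degree_le, intro allI impI)
    fix i assume "i > n"
    then consider "i = Suc n" | "i > Suc n" by linarith
    then show "coeff q i = 0"
      by cases (use Suc.prems fd in \<open>auto simp: q_def coeff_eq_0\<close>)
  qed
  from Suc.IH[OF this] obtain h
    where h: "(\<forall>k>n. h k = 0) \<and> q = (\<Sum>k\<le>n. smult (h k) (?f k))"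
    and u: "\<forall>g. (\<forall>k>n. g k = 0) \<and> q = (\<Sum>k\<le>n. smult (g k) (?f k)) \<longrightarrow> g = h"
    by (rule ex1E)
  show ?case
  proof (rule ex1I[of _ "h(Suc n := coeff p (Suc n))"], intro conjI)
    show "\<forall>k>Suc n. (h(Suc n := coeff p (Suc n))) k = 0" using h by simp
    have "p = q + smult (coeff p (Suc n)) (?f (Suc n))" by (simp add: q_def)
    then show "p = (\<Sum>k\<le>Suc n. smult ((h(Suc n := coeff p (Suc n))) k) (?f k))"
      using conjunct2[OF h] by simp
  next
    fix g assume g: "(\<forall>k>Suc n. g k = 0) \<and> p = (\<Sum>k\<le>Suc n. smult (g k) (?f k))"
    have "coeff (\<Sum>k\<le>n. smult (g k) (?f k)) (Suc n) = 0"
      by (simp add: coeff_sum coeff_eq_0 fd)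
    with g have top: "coeff p (Suc n) = g (Suc n)" by (simp add: fd)
    have "g(Suc n := 0) = h"
    proof (rule u[rule_format], intro conjI)
      show "\<forall>k>n. (g(Suc n := 0)) k = 0" using g by auto
      show "q = (\<Sum>k\<le>n. smult ((g(Suc n := 0)) k) (?f k))"
        unfolding q_def top using g by simp
    qed
    then have "h = g(Suc n := 0)" ..
    then show "g = h(Suc n := coeff p (Suc n))" by (simp add: top)
  qed
qed

lemma het_stirling_row: "is_het_stirling_row l n (het_stirling l n)"
proof -
  have "degree (deg_rising [:l:] [:0, 1:] n) \<le> n"
  proof -
    have "deg_rising [:l:] [:0, 1:] n = (\<Prod>i<n. [:real i * l, 1:])"
      unfolding deg_rising_def by (intro prod.cong) (auto simp: of_nat_poly)
    then show ?thesis by (simp add: degree_prod_sum_eq)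
  qed
  then show ?thesis
    unfolding het_stirling_def
    using falling_fact_expansion theI'[of "is_het_stirling_row l n"]
    unfolding is_het_stirling_row_def by blast
qed

end

theory Submission
  imports Defs
begin

text \<open>Put \<open>g = e_\<lambda>\<^sup>-\<^sup>1(-t)\<close>. Since \<open>(1 - \<lambda>t) g' = g\<close>, the power \<open>g\<^sup>m\<close> satisfies
  \<open>(1 - \<lambda>t) (g\<^sup>m)' = m g\<^sup>m\<close>, so that \<open>n! [t\<^sup>n] g\<^sup>m\<close> is the rising factorial
  of \<open>m\<close> of order \<open>n\<close>. Expanding \<open>g\<^sup>m = (1 + (g - 1))\<^sup>m\<close> binomially writes this as
  the sum of \<open>(n!/k! [t\<^sup>n] (g - 1)\<^sup>k) (m)\<^sub>k\<close> over \<open>k\<close>. As this holds for all natural \<open>m\<close>, it is a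
  polynomial identity, and the coefficients are the heterogeneous Stirling numbers; they are
  also the coefficients of \<open>exp (x (g - 1))\<close>.\<close>

lemma fps_lift_1 [simp]: "fps_lift 1 = 1"
  by (rule fps_ext) (simp add: fps_lift_def one_pCons)

lemma fps_lift_diff: "fps_lift (f - g) = fps_lift f - fps_lift g"
  by (rule fps_ext) (simp add: fps_lift_def)

lemma fps_lift_mult: "fps_lift (f * g) = fps_lift f * fps_lift g"
proof (rule fps_ext)
  fix n
  have sum_const: "[:sum h A:] = (\<Sum>i\<in>A. [:h i:])" for h :: "nat \<Rightarrow> real" and A
    by (rule poly_eqI) (simp add: coeff_sum coeff_pCons split: nat.split)
  show "fps_nth (fps_lift (f * g)) n = fps_nth (fps_lift f * fps_lift g) n"
    by (simp add: fps_lift_def fps_mult_nth sum_const mult.commute)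
qed

lemma fps_lift_power: "fps_lift (f ^ k) = fps_lift f ^ k"
  by (induction k) (simp_all add: fps_lift_mult)

lemma deg_rising_Suc: "deg_rising l x (Suc n) = deg_rising l x n * (x + of_nat n * l)"
  by (simp add: deg_rising_def)

lemma deg_falling_minus: "deg_falling l (- x) n = (- 1) ^ n * deg_rising l x n"
  by (induction n) (auto simp: deg_falling_def deg_rising_def algebra_simps)

text \<open>The sign (-1)^n coming from the argument -1 cancels the one coming from the substitution
  of -t.\<close>

lemma deg_exp_neg_nth:
  "fps_nth (fps_compose (deg_exp l (- 1)) (- fps_X)) n = deg_rising l 1 n / fact n"
  by (simp add: fps_compose_uminus' deg_exp_def deg_falling_minus flip: power_mult_distrib)

text \<open>At t^n this is the recurrence (n+1) g_(n+1) = (1 + n l) g_n, which reflects the last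
  factor of the rising factorial of 1.\<close>

lemma deg_exp_neg_ODE:
  fixes l :: real
  defines "g \<equiv> fps_compose (deg_exp l (- 1)) (- fps_X)"
  shows "(1 - fps_const l * fps_X) * fps_deriv g = g"
proof (rule fps_ext)
  fix n
  have "real (Suc n) * fps_nth g (Suc n) = (1 + of_nat n * l) * fps_nth g n"
    by (simp add: g_def deg_exp_neg_nth deg_rising_Suc del: of_nat_Suc)
  then show "fps_nth ((1 - fps_const l * fps_X) * fps_deriv g) n = fps_nth g n"
    by (cases n) (simp_all add: algebra_simps mult.assoc)
qed

lemma deg_exp_neg_power_nth:
  fixes l :: real
  defines "g \<equiv> fps_compose (deg_exp l (- 1)) (- fps_X)"
  shows "fact n * fps_nth (g ^ m) n = deg_rising l (of_nat m) n"
proof (induction n)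
  case 0
  have "fps_nth g 0 = 1"
    by (simp add: g_def deg_exp_def deg_falling_def)
  then show ?case
    by (simp add: deg_rising_def fps_power_zeroth)
next
  case (Suc n)
  \<comment> \<open>The power rule carries the equation for \<open>g\<close> over to
    \<open>g ^ m\<close>; writing m as \<open>Suc k\<close> lets \<open>g * g ^ k\<close>
    recombine.\<close>
  have "(1 - fps_const l * fps_X) * fps_deriv (g ^ m) = of_nat m * g ^ m"
  proof (cases m)
    case (Suc k)
    have "(1 - fps_const l * fps_X) * fps_deriv (g ^ m)
        = of_nat m * ((1 - fps_const l * fps_X) * fps_deriv g) * g ^ k"
      by (simp only: fps_deriv_power' mult_ac Suc diff_Suc_1)
    also have "\<dots> = of_nat m * g ^ m"
      by (simp only: deg_exp_neg_ODE[of l, folded g_def] Suc power_Suc mult.assoc)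
    finally show ?thesis .
  qed simp
  then have "fps_nth ((1 - fps_const l * fps_X) * fps_deriv (g ^ m)) n =
      fps_nth (fps_const (of_nat m) * g ^ m) n"
    by (simp add: fps_of_nat)
  then have "real (Suc n) * fps_nth (g ^ m) (Suc n) = (of_nat m + of_nat n * l) * fps_nth (g ^ m) n"
    by (cases n) (simp_all add: algebra_simps mult.assoc)
  then have "fact (Suc n) * fps_nth (g ^ m) (Suc n)
      = (of_nat m + of_nat n * l) * (fact n * fps_nth (g ^ m) n)"
    by (simp add: mult_ac del: of_nat_Suc)
  then show ?case
    by (simp only: Suc.IH deg_rising_Suc mult.commute)
qed

lemma poly_deg_rising: "poly (deg_rising [:l:] p n) x = deg_rising l (poly p x) n"
  by (simp add: deg_rising_def poly_prod mult.commute)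

lemma poly_falling_fact_of_nat:
  "poly (falling_fact [:0, 1:] k) (real m) = fact k * real (m choose k)"
  by (simp add: falling_fact_def poly_prod binomial_gbinomial gbinomial_mult_fact
      flip: atLeast0LessThan)

text \<open>Otherwise the nonzero difference would have infinitely many roots, since the
  \<open>of_nat m\<close> are distinct in characteristic 0.\<close>

lemma poly_eqI_of_nat:
  fixes p q :: "'a::{idom,ring_char_0} poly"
  assumes "\<And>m. poly p (of_nat m) = poly q (of_nat m)"
  shows "p = q"
proof (rule ccontr)
  assume "p \<noteq> q"
  then have "finite {x. poly (p - q) x = 0}"
    by (intro poly_roots_finite) simp
  moreover have "range of_nat \<subseteq> {x. poly (p - q) x = 0}"
    using assms by auto
  ultimately show False
    using finite_subset infinite_UNIV_char_0 range_inj_infinite[OF inj_of_nat] by blast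
qed

text \<open>This allows \<open>het_stirling\<close> to be computed by checking a candidate
  row.\<close>

lemma is_het_stirling_row_unique:
  assumes "is_het_stirling_row l n h"
  shows "h = het_stirling l n"
proof -
  have "degree (\<Sum>k\<le>n. smult (h k) (falling_fact [:0, 1:] k)) \<le> n"
    by (intro degree_sum_le order.trans[OF degree_smult_le])
      (auto simp: falling_fact_degree_coeff)
  from falling_fact_expansion[OF this] show ?thesis
    using assms het_stirling_row[of l n] unfolding is_het_stirling_row_def by metis
qed

lemma het_stirling_eq:
  fixes l :: real
  defines "g \<equiv> fps_compose (deg_exp l (- 1)) (- fps_X)"
  shows "het_stirling l n k = fact n / fact k * fps_nth ((g - 1) ^ k) n"
proof -
  define h where "h k = fact n / fact k * fps_nth ((g - 1) ^ k) n" for k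
  have g0: "fps_nth (g - 1) 0 = 0"
    by (simp add: g_def deg_exp_def deg_falling_def)
  \<comment> \<open>As \<open>g - 1\<close> has no constant term, its k-th power has no terms below
    t^k.\<close>
  have h0: "h k = 0" if "k > n" for k
    using that startsby_zero_power_prefix[OF g0, of k] by (simp add: h_def)
  have "poly (deg_rising [:l:] [:0, 1:] n) (real m) =
      poly (\<Sum>k\<le>n. smult (h k) (falling_fact [:0, 1:] k)) (real m)" for m
  proof -
    have "poly (deg_rising [:l:] [:0, 1:] n) (real m) = fact n * fps_nth (((g - 1) + 1) ^ m) n"
      by (simp add: poly_deg_rising g_def deg_exp_neg_power_nth)
    also have "\<dots> = (\<Sum>k\<le>m. h k * (fact k * real (m choose k)))"
      by (subst binomial_ring)
        (simp add: fps_sum_nth sum_distrib_left h_def mult_ac flip: fps_of_nat)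
    \<comment> \<open>The range must become independent of m. Terms with k > m vanish through
      \<open>m choose k\<close>, those with k > n through \<open>h0\<close>.\<close>
    also have "\<dots> = (\<Sum>k\<le>max m n. h k * (fact k * real (m choose k)))"
      by (rule sum.mono_neutral_left) auto
    also have "\<dots> = (\<Sum>k\<le>n. h k * (fact k * real (m choose k)))"
      by (rule sum.mono_neutral_right) (auto simp: h0)
    finally show ?thesis
      by (simp add: poly_sum poly_falling_fact_of_nat)
  qed
  then have "is_het_stirling_row l n h"
    unfolding is_het_stirling_row_def using h0 by (auto intro: poly_eqI_of_nat)
  then show ?thesis
    by (simp add: h_def flip: is_het_stirling_row_unique)
qed

text \<open>Powers of \<open>p\<close> are constants in t and factor out; the cutoff at n is that of
  \<open>fps_compose\<close> and matches \<open>het_bell\<close>.\<close>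

lemma exp_series_nth:
  "fps_nth (exp_series (fps_const p * fps_lift f)) n
    = (\<Sum>k\<le>n. smult (fps_nth (f ^ k) n / fact k) (p ^ k))"
  by (simp add: exp_series_def fps_compose_nth power_mult_distrib fps_const_power
      fps_lift_def[of "fps_exp 1"] flip: fps_lift_power)
    (simp add: fps_lift_def atLeast0AtMost mult_ac)

theorem theorem2p9:
  fixes l :: real
  assumes "l \<noteq> 0"
  shows "exp_series (fps_const [:0, 1:] * (fps_lift (fps_compose (deg_exp l (-1)) (- fps_X)) - 1))
           = Abs_fps (\<lambda>n. smult (1 / fact n) (het_bell l n))"
proof (rule fps_ext)
  fix n
  define g where "g = fps_compose (deg_exp l (- 1)) (- fps_X)"
  have "fps_nth (exp_series (fps_const [:0, 1:] * (fps_lift g - 1))) n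
      = fps_nth (exp_series (fps_const [:0, 1:] * fps_lift (g - 1))) n"
    by (simp add: fps_lift_diff)
  \<comment> \<open>The factor n! in \<open>het_stirling_eq\<close> cancels against 1/n!.\<close>
  also have "\<dots> = smult (1 / fact n) (het_bell l n)"
    by (rule poly_eqI)
      (simp add: exp_series_nth het_bell_def coeff_sum sum_distrib_left het_stirling_eq g_def)
  finally show "fps_nth (exp_series (fps_const [:0, 1:] *
        (fps_lift (fps_compose (deg_exp l (-1)) (- fps_X)) - 1))) n
      = fps_nth (Abs_fps (\<lambda>n. smult (1 / fact n) (het_bell l n))) n"
    by (simp add: g_def)
qed

end
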